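(* Let $G$ and $H$ be (finite, simple, connected) graphs with $H\neq K_1$. Then $$\beta(G\,\square\,H)\leq \beta(G)+\psi(H)-1.$$
   Context: All graphs are finite, undirected, simple and connected; $d(v,w)$ denotes the shortest-path distance. A vertex $x$ resolves a pair $v,w$ if $d(v,x)\neq d(w,x)$. A set $S\subseteq V(G)$ resolves $G$ if every pair of distinct vertices of $G$ is resolved by some vertex of $S$; $\beta(G)$ (the metric dimension) is the minimum cardinality of a resolving set of $G$. For a graph $G\neq K_1$, two vertices $v,w$ are doubly resolved by $x,y$ if $d(v,x)-d(w,x)\neq d(v,y)-d(w,y)$; a set $S\subseteq V(G)$ is doubly resolving if every pair of distinct vertices of $G$ is doubly resolved by two vertices of $S$; $\psi(G)$ is the minimum cardinality of a doubly resolving set of $G$. The cartesian product $G\,\square\,H$ has vertex set $V(G)\times V(H)$, with $(a,v)$ adjacent to $(b,w)$ iff ($a=b$ and $vw\in E(H)$) or ($v=w$ and $ab\in E(G)$).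
   Formalization: The metric dimension is taken over nonempty resolving sets, so β(K_1)=1; with β(K_1)=0 the bound fails for G=K_1, H=K_3 (2 ≤ 0+2−1). For all other connected graphs β is unchanged. *)

theory Defs
  imports "Graph_Theory.Graph_Theory"
begin

text \<open>A simple undirected graph is a \<open>pair_graph\<close>: finite, loopless, with a symmetric arc
  relation, so that each edge \<open>vw\<close> is the pair of arcs \<open>(v, w)\<close> and \<open>(w, v)\<close>.\<close>

text \<open>The underlying \<open>LEAST\<close> is meaningful only for vertices joined by a walk; in the theorem
  all graphs are connected.\<close>

definition graph_dist :: "'a pair_pre_digraph \<Rightarrow> 'a \<Rightarrow> 'a \<Rightarrow> nat" where
  "graph_dist G u v = (LEAST n. \<exists>p. pre_digraph.awalk (with_proj G) u p v \<and> length p = n)"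

definition resolves :: "'a pair_pre_digraph \<Rightarrow> 'a \<Rightarrow> 'a \<Rightarrow> 'a \<Rightarrow> bool" where
  "resolves G x v w \<longleftrightarrow> graph_dist G v x \<noteq> graph_dist G w x"

definition resolving_set :: "'a pair_pre_digraph \<Rightarrow> 'a set \<Rightarrow> bool" where
  "resolving_set G S \<longleftrightarrow> S \<subseteq> pverts G \<and>
     (\<forall>v\<in>pverts G. \<forall>w\<in>pverts G. v \<noteq> w \<longrightarrow> (\<exists>x\<in>S. resolves G x v w))"

text \<open>The condition \<open>S \<noteq> {}\<close> matters only for the one-vertex graph, where the empty set resolves
  vacuously (see \<open>metric_dim_eq\<close> below). It fixes the convention \<open>\<beta>(K\<^sub>1) = 1\<close>. With
  \<open>\<beta>(K\<^sub>1) = 0\<close> the bound would fail for \<open>G = K\<^sub>1\<close>, \<open>H = K\<^sub>3\<close>, since \<open>\<beta>(K\<^sub>3) = \<psi>(K\<^sub>3) = 2\<close>.\<close>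

definition metric_dim :: "'a pair_pre_digraph \<Rightarrow> nat" where
  "metric_dim G = (LEAST n. \<exists>S. resolving_set G S \<and> S \<noteq> {} \<and> card S = n)"

definition doubly_resolves :: "'a pair_pre_digraph \<Rightarrow> 'a \<Rightarrow> 'a \<Rightarrow> 'a \<Rightarrow> 'a \<Rightarrow> bool" where
  "doubly_resolves G x y v w \<longleftrightarrow>
     int (graph_dist G v x) - int (graph_dist G w x) \<noteq>
     int (graph_dist G v y) - int (graph_dist G w y)"

definition doubly_resolving_set :: "'a pair_pre_digraph \<Rightarrow> 'a set \<Rightarrow> bool" where
  "doubly_resolving_set G S \<longleftrightarrow> S \<subseteq> pverts G \<and>
     (\<forall>v\<in>pverts G. \<forall>w\<in>pverts G. v \<noteq> w \<longrightarrow> (\<exists>x\<in>S. \<exists>y\<in>S. doubly_resolves G x y v w))"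

text \<open>The number \<open>\<psi>(G)\<close>, meant for graphs other than \<open>K\<^sub>1\<close>.\<close>

definition double_metric_dim :: "'a pair_pre_digraph \<Rightarrow> nat" where
  "double_metric_dim G = (LEAST n. \<exists>S. doubly_resolving_set G S \<and> card S = n)"

definition cart_prod ::
  "'a pair_pre_digraph \<Rightarrow> 'b pair_pre_digraph \<Rightarrow> ('a \<times> 'b) pair_pre_digraph" where
  "cart_prod G H = \<lparr> pverts = pverts G \<times> pverts H,
     parcs = {((a, v), (b, w)) | a v b w.
       a \<in> pverts G \<and> b \<in> pverts G \<and> v \<in> pverts H \<and> w \<in> pverts H \<and>
       (a = b \<and> (v, w) \<in> parcs H \<or> v = w \<and> (a, b) \<in> parcs G)} \<rparr>"

lemma metric_dim_eq:
  assumes "pair_graph G" "connected (with_proj G)" "card (pverts G) \<noteq> 1"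
  shows "metric_dim G = (LEAST n. \<exists>S. resolving_set G S \<and> card S = n)"
proof -
  interpret pair_graph G by fact
  have "pverts G \<noteq> {}"
    using assms(2) by (auto simp: connected_def strongly_connected_def mk_symmetric_def)
  then obtain v where v: "v \<in> pverts G" by blast
  with assms(3) have "pverts G \<noteq> {v}" by auto
  with v obtain w where "w \<in> pverts G" "v \<noteq> w" by blast
  with v have "\<not> resolving_set G {}" by (auto simp: resolving_set_def)
  then have "(\<exists>S. resolving_set G S \<and> S \<noteq> {} \<and> card S = n) \<longleftrightarrow>
      (\<exists>S. resolving_set G S \<and> card S = n)" for n
    by metis
  then show ?thesis by (simp add: metric_dim_def)
qed

text \<open>\<open>graph_dist\<close> agrees with the weighted distance of \<open>Graph_Theory\<close> for unit weights.\<close>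

lemma graph_dist_eq_mu:
  assumes "pair_graph G" "connected (with_proj G)" "u \<in> pverts G" "v \<in> pverts G"
  shows "wf_digraph.\<mu> (with_proj G) (\<lambda>_. 1) u v = ereal (real (graph_dist G u v))"
proof -
  interpret pair_graph G by fact
  have cost: "awalk_cost (\<lambda>_. 1) p = real (length p)" for p :: "('a \<times> 'a) list"
    by (induct p) simp_all
  have "strongly_connected (with_proj G)"
    using assms(2) by (intro symmetric_connected_imp_strongly_connected pair_sym_arcs)
  then have "u \<rightarrow>\<^sup>*\<^bsub>with_proj G\<^esub> v"
    using assms(3,4) by (auto simp: strongly_connected_def)
  then have ex: "\<exists>n p. awalk u p v \<and> length p = n"
    by (simp add: reachable_awalk)
  from LeastI_ex[OF ex] obtain p where p: "awalk u p v" "length p = graph_dist G u v"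
    unfolding graph_dist_def by blast
  have least: "graph_dist G u v \<le> length q" if "awalk u q v" for q
    unfolding graph_dist_def using that by (intro Least_le) blast
  show ?thesis
    unfolding \<mu>_def
  proof (rule antisym)
    show "(INF q\<in>{q. awalk u q v}. ereal (awalk_cost (\<lambda>_. 1) q)) \<le> ereal (real (graph_dist G u v))"
      using p by (intro INF_lower2[of p]) (simp_all add: cost)
    show "ereal (real (graph_dist G u v)) \<le> (INF q\<in>{q. awalk u q v}. ereal (awalk_cost (\<lambda>_. 1) q))"
      using least by (intro INF_greatest) (simp add: cost)
  qed
qed

end

theory Submission
  imports Defs
begin

text \<open>If \<open>S\<close> resolves \<open>G\<close> and \<open>T\<close> doubly resolves \<open>H\<close>, take the cross
  \<open>S \<times> {t} \<union> {s} \<times> T\<close> with centre \<open>(s, t)\<close>. Distances add in the product, so the arm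
  \<open>S \<times> {t}\<close> separates vertices \<open>(a, v) \<noteq> (b, v)\<close>. If \<open>v \<noteq> w\<close>, the difference
  \<open>d(v, x) - d(w, x)\<close> takes two values for \<open>x \<in> T\<close>; one of them is not
  \<open>d(b, s) - d(a, s)\<close>, and then \<open>(s, x)\<close> resolves \<open>(a, v)\<close> and \<open>(b, w)\<close>.\<close>

context pair_wf_digraph
begin

text \<open>Replaces walks by powers of the arc relation, where walks can be composed with
  \<open>relpow_add\<close> and projected by induction on the length. The conjunct
  \<open>u \<in> pverts G\<close> matters for n = 0: the zeroth power is the identity on the whole
  type, whereas an empty walk has to start at a vertex.\<close>

lemma awalk_length_iff_relpow:
  "(\<exists>p. awalk u p v \<and> length p = n) \<longleftrightarrow> u \<in> pverts G \<and> (u, v) \<in> parcs G ^^ n"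
proof (induction n arbitrary: u)
  case 0
  then show ?case by (auto simp: awalk_Nil_iff)
next
  case (Suc n)
  have "(\<exists>p. awalk u p v \<and> length p = Suc n) \<longleftrightarrow>
      (\<exists>e p. awalk u (e # p) v \<and> length p = n)"
    unfolding length_Suc_conv by blast
  also have "\<dots> \<longleftrightarrow> (\<exists>w. (u, w) \<in> parcs G \<and> (\<exists>p. awalk w p v \<and> length p = n))"
    by (simp add: awalk_Cons_iff)
  also have "\<dots> \<longleftrightarrow> (\<exists>w. (u, w) \<in> parcs G \<and> (w, v) \<in> parcs G ^^ n)"
    using Suc.IH in_arcsD2 by blast
  also have "\<dots> \<longleftrightarrow> u \<in> pverts G \<and> (u, v) \<in> parcs G ^^ Suc n"
    using in_arcsD1 by (blast intro: relpow_Suc_I2 elim: relpow_Suc_E2)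
  finally show ?case .
qed

lemma graph_dist_relpow:
  assumes "u \<in> pverts G"
  shows "graph_dist G u v = (LEAST n. (u, v) \<in> parcs G ^^ n)"
  unfolding graph_dist_def awalk_length_iff_relpow using assms by simp

lemma graph_dist_le:
  assumes "u \<in> pverts G" "(u, v) \<in> parcs G ^^ n"
  shows "graph_dist G u v \<le> n"
  using assms by (simp add: graph_dist_relpow Least_le)

lemma graph_dist_self: "u \<in> pverts G \<Longrightarrow> graph_dist G u u = 0"
  using graph_dist_le[of u u 0] by simp

end

context pair_graph
begin

text \<open>Since arcs are symmetric, connectedness gives a walk from u to v, so the
  \<open>LEAST\<close> in the distance is attained.\<close>

lemma relpow_graph_dist:
  assumes "connected (with_proj G)" "u \<in> pverts G" "v \<in> pverts G"
  shows "(u, v) \<in> parcs G ^^ graph_dist G u v"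
proof -
  have "strongly_connected (with_proj G)"
    using assms(1) by (intro symmetric_connected_imp_strongly_connected pair_sym_arcs)
  then have "\<exists>p. awalk u p v"
    using assms(2,3) by (auto simp: strongly_connected_def reachable_awalk)
  then have "\<exists>n. (u, v) \<in> parcs G ^^ n"
    using awalk_length_iff_relpow by blast
  then show ?thesis
    unfolding graph_dist_relpow[OF assms(2)] by (rule LeastI_ex)
qed

lemma graph_dist_pos:
  assumes "connected (with_proj G)" "u \<in> pverts G" "v \<in> pverts G" "u \<noteq> v"
  shows "graph_dist G u v > 0"
  using relpow_graph_dist[OF assms(1-3)] assms(4) by (cases "graph_dist G u v") auto

text \<open>Guarantees that the minimum defining \<open>metric_dim\<close> exists. The vertex v
  resolves v and w itself, being at distance 0 from v and at positive distance from w.\<close>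

lemma resolving_set_pverts:
  assumes "connected (with_proj G)"
  shows "resolving_set G (pverts G)"
  unfolding resolving_set_def
proof (intro conjI ballI impI)
  fix v w assume vw: "v \<in> pverts G" "w \<in> pverts G" "v \<noteq> w"
  then have "resolves G v v w"
    using graph_dist_self graph_dist_pos[OF assms, of w v] by (simp add: resolves_def)
  with vw show "\<exists>x\<in>pverts G. resolves G x v w" by blast
qed simp

lemma doubly_resolving_set_pverts:
  assumes "connected (with_proj G)"
  shows "doubly_resolving_set G (pverts G)"
  unfolding doubly_resolving_set_def
proof (intro conjI ballI impI)
  fix v w assume vw: "v \<in> pverts G" "w \<in> pverts G" "v \<noteq> w"
  \<comment> \<open>The difference d(v, x) - d(w, x) is at most 0 at x = v and positive at x =
    w.\<close>
  then have "doubly_resolves G v w v w"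
    using graph_dist_self graph_dist_pos[OF assms, of v w] by (simp add: doubly_resolves_def)
  with vw show "\<exists>x\<in>pverts G. \<exists>y\<in>pverts G. doubly_resolves G x y v w" by blast
qed simp

end

lemma pverts_cart_prod [simp]: "pverts (cart_prod G H) = pverts G \<times> pverts H"
  by (simp add: cart_prod_def)

lemma pair_wf_digraph_cart_prod: "pair_wf_digraph (cart_prod G H)"
  by unfold_locales (auto simp: cart_prod_def)

text \<open>Each arc of the product moves one coordinate and fixes the other, so a walk splits into
  its two projections. This yields the lower bound for distances in the product.\<close>

lemma relpow_cart_prodD:
  assumes "((a, v), (b, w)) \<in> parcs (cart_prod G H) ^^ n"
  shows "\<exists>i j. n = i + j \<and> (a, b) \<in> parcs G ^^ i \<and> (v, w) \<in> parcs H ^^ j"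
  using assms
proof (induction n arbitrary: b w)
  case 0
  then have "a = b" "v = w" by auto
  then show ?case by (intro exI[of _ 0]) simp
next
  case (Suc n)
  then obtain c x where cx: "((a, v), (c, x)) \<in> parcs (cart_prod G H) ^^ n"
      "((c, x), (b, w)) \<in> parcs (cart_prod G H)"
    by (auto elim: relpow_Suc_E)
  from Suc.IH[OF cx(1)] obtain i j where ij: "n = i + j" "(a, c) \<in> parcs G ^^ i"
      "(v, x) \<in> parcs H ^^ j" by blast
  from cx(2) consider "c = b" "(x, w) \<in> parcs H" | "x = w" "(c, b) \<in> parcs G"
    by (auto simp: cart_prod_def)
  then show ?case
  proof cases
    case 1
    with ij have "Suc n = i + Suc j" "(a, b) \<in> parcs G ^^ i" "(v, w) \<in> parcs H ^^ Suc j"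
      by auto
    then show ?thesis by blast
  next
    case 2
    with ij have "Suc n = Suc i + j" "(a, b) \<in> parcs G ^^ Suc i" "(v, w) \<in> parcs H ^^ j"
      by auto
    then show ?thesis by blast
  qed
qed

text \<open>A walk in G lifts to the layer over v. Well-formedness places the ends of each arc in
  \<open>pverts G\<close>, which \<open>cart_prod\<close> requires of its arcs.\<close>

lemma relpow_cart_prod_left:
  assumes "pair_wf_digraph G" "v \<in> pverts H" "(a, b) \<in> parcs G ^^ n"
  shows "((a, v), (b, v)) \<in> parcs (cart_prod G H) ^^ n"
  using assms(3)
proof (induction n arbitrary: b)
  case (Suc n)
  then obtain c where "(a, c) \<in> parcs G ^^ n" "(c, b) \<in> parcs G"
    by (auto elim: relpow_Suc_E)
  moreover from this(2) have "((c, v), (b, v)) \<in> parcs (cart_prod G H)"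
    using assms(2) pair_wf_digraph.in_arcsD1[OF assms(1)] pair_wf_digraph.in_arcsD2[OF assms(1)]
    by (auto simp: cart_prod_def)
  ultimately show ?case using Suc.IH by (auto intro: relpow_Suc_I)
qed simp

lemma relpow_cart_prod_right:
  assumes "pair_wf_digraph H" "a \<in> pverts G" "(v, w) \<in> parcs H ^^ n"
  shows "((a, v), (a, w)) \<in> parcs (cart_prod G H) ^^ n"
  using assms(3)
proof (induction n arbitrary: w)
  case (Suc n)
  then obtain x where "(v, x) \<in> parcs H ^^ n" "(x, w) \<in> parcs H"
    by (auto elim: relpow_Suc_E)
  moreover from this(2) have "((a, x), (a, w)) \<in> parcs (cart_prod G H)"
    using assms(2) pair_wf_digraph.in_arcsD1[OF assms(1)] pair_wf_digraph.in_arcsD2[OF assms(1)]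
    by (auto simp: cart_prod_def)
  ultimately show ?case using Suc.IH by (auto intro: relpow_Suc_I)
qed simp

lemma graph_dist_cart_prod:
  assumes "pair_graph G" "connected (with_proj G)" "pair_graph H" "connected (with_proj H)"
    and "a \<in> pverts G" "b \<in> pverts G" "v \<in> pverts H" "w \<in> pverts H"
  shows "graph_dist (cart_prod G H) (a, v) (b, w) = graph_dist G a b + graph_dist H v w"
proof -
  interpret G: pair_graph G by fact
  interpret H: pair_graph H by fact
  interpret P: pair_wf_digraph "cart_prod G H" by (rule pair_wf_digraph_cart_prod)
  \<comment> \<open>Upper bound: go from (a, v) to (b, v) along a shortest walk in G, then to (b, w)
    along one in H.\<close>
  have "((a, v), (b, w)) \<in> parcs (cart_prod G H) ^^ (graph_dist G a b + graph_dist H v w)"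
    unfolding relpow_add
    using relpow_cart_prod_left[OF G.pair_wf_digraph_axioms assms(7)
        G.relpow_graph_dist[OF assms(2,5,6)]]
      relpow_cart_prod_right[OF H.pair_wf_digraph_axioms assms(6)
        H.relpow_graph_dist[OF assms(4,7,8)]]
    by blast
  moreover have "graph_dist G a b + graph_dist H v w \<le> n"
    if "((a, v), (b, w)) \<in> parcs (cart_prod G H) ^^ n" for n
    using relpow_cart_prodD[OF that] G.graph_dist_le[OF assms(5)] H.graph_dist_le[OF assms(7)]
    by (auto intro: add_mono)
  ultimately show ?thesis
    using assms(5,7) by (subst P.graph_dist_relpow) (auto intro: Least_equality)
qed

lemma resolving_set_cart_prod:
  assumes "pair_graph G" "connected (with_proj G)" "pair_graph H" "connected (with_proj H)"
    and S: "resolving_set G S" "s \<in> S" and T: "doubly_resolving_set H T" "t \<in> T"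
  shows "resolving_set (cart_prod G H) (S \<times> {t} \<union> {s} \<times> T)"
proof -
  note dist = graph_dist_cart_prod[OF assms(1-4)]
  have SG: "S \<subseteq> pverts G" and TH: "T \<subseteq> pverts H"
    using S T by (auto simp: resolving_set_def doubly_resolving_set_def)
  have "\<exists>z\<in>S \<times> {t} \<union> {s} \<times> T. resolves (cart_prod G H) z (a, v) (b, w)"
    if ab: "a \<in> pverts G" "b \<in> pverts G" and vw: "v \<in> pverts H" "w \<in> pverts H"
      and ne: "(a, v) \<noteq> (b, w)" for a b v w
  proof (cases "v = w")
    case True
    with ne ab obtain x where x: "x \<in> S" "resolves G x a b"
      using S(1) unfolding resolving_set_def by blast
    with True ab vw SG TH T(2) have "resolves (cart_prod G H) (x, t) (a, v) (b, w)"
      by (auto simp: resolves_def dist subset_iff)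
    with x show ?thesis by blast
  next
    case False
    with vw obtain x y where "x \<in> T" "y \<in> T" "doubly_resolves H x y v w"
      using T(1) unfolding doubly_resolving_set_def by blast
    \<comment> \<open>The differences at x and y are distinct, so the right-hand side misses at
      least one of them, and z is x or y accordingly. Rearranged, the inequality reads d(a, s) +
      d(v, z) \<noteq> d(b, s) + d(w, z).\<close>
    then obtain z where z: "z \<in> T" "int (graph_dist H v z) - int (graph_dist H w z) \<noteq>
        int (graph_dist G b s) - int (graph_dist G a s)"
      unfolding doubly_resolves_def by metis
    moreover have "s \<in> pverts G" "z \<in> pverts H"
      using SG TH S(2) z(1) by auto
    ultimately have "resolves (cart_prod G H) (s, z) (a, v) (b, w)"
      using ab vw by (simp add: resolves_def dist)
    with z(1) show ?thesis by blast
  qed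
  moreover have "S \<times> {t} \<union> {s} \<times> T \<subseteq> pverts (cart_prod G H)"
    using SG TH S(2) T(2) by auto
  ultimately show ?thesis unfolding resolving_set_def by auto
qed

text \<open>The two arms share only the centre (s, t), which accounts for the -1 in the bound.
  Adding 1 on the left avoids truncated subtraction.\<close>

lemma card_cross:
  assumes "finite S" "finite T" "s \<in> S" "t \<in> T"
  shows "card (S \<times> {t} \<union> {s} \<times> T) + 1 = card S + card T"
proof -
  have "S \<times> {t} \<inter> {s} \<times> T = {(s, t)}" using assms by auto
  then show ?thesis
    using card_Un_Int[of "S \<times> {t}" "{s} \<times> T"] assms by (simp add: card_cartesian_product)
qed

theorem theorem4p1:
  fixes G :: "'a pair_pre_digraph" and H :: "'b pair_pre_digraph"
  assumes "pair_graph G" and "connected (with_proj G)"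
    and "pair_graph H" and "connected (with_proj H)"
    and "card (pverts H) \<noteq> 1"
  shows "int (metric_dim (cart_prod G H)) \<le> int (metric_dim G) + int (double_metric_dim H) - 1"
proof -
  interpret G: pair_graph G by fact
  interpret H: pair_graph H by fact
  have ne: "pverts G \<noteq> {}" "pverts H \<noteq> {}"
    using assms(2,4) by (auto simp: connected_def strongly_connected_def mk_symmetric_def)
  then have "\<exists>n S. resolving_set G S \<and> S \<noteq> {} \<and> card S = n"
    using G.resolving_set_pverts[OF assms(2)] by blast
  from LeastI_ex[OF this] obtain S where
    S: "resolving_set G S" "S \<noteq> {}" "card S = metric_dim G"
    unfolding metric_dim_def by blast
  have "\<exists>n T. doubly_resolving_set H T \<and> card T = n"
    using H.doubly_resolving_set_pverts[OF assms(4)] by blast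
  from LeastI_ex[OF this] obtain T where
    T: "doubly_resolving_set H T" "card T = double_metric_dim H"
    unfolding double_metric_dim_def by blast
  \<comment> \<open>Two distinct vertices of H are what forces T to be nonempty; on a single vertex
    the empty set would doubly resolve vacuously.\<close>
  obtain v w where "v \<in> pverts H" "w \<in> pverts H" "v \<noteq> w"
    using ne(2) assms(5) by (metis is_singletonI' is_singleton_altdef)
  with T(1) obtain t where t: "t \<in> T" unfolding doubly_resolving_set_def by blast
  from S(2) obtain s where s: "s \<in> S" by blast
  have fin: "finite S" "finite T"
    using S(1) T(1) finite_subset[OF _ G.pair_finite_verts] finite_subset[OF _ H.pair_finite_verts]
    by (auto simp: resolving_set_def doubly_resolving_set_def)
  \<comment> \<open>The membership of s in S also shows that the cross is nonempty, as
    \<open>metric_dim\<close> demands.\<close>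
  have "metric_dim (cart_prod G H) \<le> card (S \<times> {t} \<union> {s} \<times> T)"
    unfolding metric_dim_def
    using resolving_set_cart_prod[OF assms(1-4) S(1) s T(1) t] s by (intro Least_le) blast
  then show ?thesis using card_cross[OF fin s t] S(3) T(2) by linarith
qed

end
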